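(* Let $\gamma = \frac{1}{\log_2(3/2)} - 1$. For every integer $n \ge 1$ and every nonempty $A \subset \{0,1\}^n$ with $\mu(A) \le 1/2$, $$\mathbb{E}\, h_A \;\ge\; \left(\frac{\mu(A)}{\mu(\partial A)}\right)^{\gamma} \mu(A)\,\log_2\!\Big(\frac{1}{\mu(A)}\Big).$$ Moreover, equality holds whenever such an $A$ is a subcube.
   Context: The hypercube $\{0,1\}^n$ is regarded as a graph in which two vertices are adjacent iff they differ in exactly one coordinate. $\mu$ is the uniform probability measure on $\{0,1\}^n$ and $\mathbb{E}$ is expectation with respect to $\mu$. For $A \subset \{0,1\}^n$, $h_A:\{0,1\}^n \to \mathbb{R}$ is defined by $h_A(x)=0$ if $x \notin A$, and, if $x \in A$, $h_A(x)$ is the number of neighbours of $x$ lying in $A^c = \{0,1\}^n\setminus A$. The vertex boundary of $A$ is $\partial A = \operatorname{supp}(h_A) = \{x : h_A(x) \neq 0\} \subset A$. A subcube is a set obtained by fixing the values of some of the coordinates. *)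

theory Defs
  imports "HOL-Probability.Probability"
begin

definition cube :: "nat \<Rightarrow> bool list set" where
  "cube n = {x. length x = n}"

definition adjacent :: "nat \<Rightarrow> bool list \<Rightarrow> bool list \<Rightarrow> bool" where
  "adjacent n x y \<longleftrightarrow> x \<in> cube n \<and> y \<in> cube n \<and> (\<exists>!i. i < n \<and> x ! i \<noteq> y ! i)"

abbreviation cube_prob :: "nat \<Rightarrow> bool list set \<Rightarrow> real" where
  "cube_prob n A \<equiv> measure_pmf.prob (pmf_of_set (cube n)) A"

abbreviation cube_expectation :: "nat \<Rightarrow> (bool list \<Rightarrow> real) \<Rightarrow> real" where
  "cube_expectation n f \<equiv> measure_pmf.expectation (pmf_of_set (cube n)) f"

definition out_deg :: "nat \<Rightarrow> bool list set \<Rightarrow> bool list \<Rightarrow> real" where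
  "out_deg n A x = (if x \<in> A then real (card {y \<in> cube n - A. adjacent n x y}) else 0)"

text \<open>The inner vertex boundary: a subset of \<open>A\<close> itself.\<close>
definition vertex_boundary :: "nat \<Rightarrow> bool list set \<Rightarrow> bool list set" where
  "vertex_boundary n A = {x \<in> cube n. out_deg n A x \<noteq> 0}"

definition is_subcube :: "nat \<Rightarrow> bool list set \<Rightarrow> bool" where
  "is_subcube n A \<longleftrightarrow> (\<exists>I a. I \<subseteq> {..<n} \<and> A = {x \<in> cube n. \<forall>i\<in>I. x ! i = a i})"

definition \<gamma> :: real where
  "\<gamma> = 1 / log 2 (3/2) - 1"

text \<open>\<^const>\<open>pmf_of_set\<close> is the uniform distribution only on finite nonempty sets.\<close>
lemma finite_cube: "finite (cube n)"
  using finite_lists_length_eq[of "UNIV :: bool set" n] by (simp add: cube_def)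

lemma cube_nonempty: "cube n \<noteq> {}"
  unfolding cube_def using length_replicate[of n True] by blast

end

theory Submission
  imports Defs
begin

text \<open>
  Put \<open>\<beta> = log 2 (3/2)\<close>. By Hoelder, the claim follows from
  \<open>E h_A^\<beta> \<ge> \<mu>(A) (log 2 (1/\<mu>(A)))^\<beta>\<close> for \<open>\<mu>(A) \<le> 1/2\<close>. This is proved by induction on the dimension
  together with the bound \<open>E h_A^\<beta> \<ge> 2 \<mu>(A) (1 - \<mu>(A))\<close>, valid for every \<open>A\<close>. Halving the cube
  splits \<open>A\<close> into slices of densities \<open>x \<ge> y\<close>, and a point of the larger slice that is missing from
  the smaller one gains a neighbour outside \<open>A\<close>. Hence each bound \<open>B\<close> propagates if
  \<open>2 B((x + y)/2) \<le> B(y) + max ((B(x)^(1/\<beta>) + (x - y)^(1/\<beta>))^\<beta>) (x - y + B(x)/2)\<close>, where the first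
  alternative is the reverse Minkowski inequality and the second uses that \<open>h_A\<close> is integral.
  The quadratic bound always propagates. The entropy bound propagates when \<open>x + y \<le> 1/2\<close>, and for
  \<open>\<mu>(A)\<close> between \<open>1/4\<close> and \<open>1/2\<close> it is implied by the quadratic one.
\<close>

subsection \<open>Powers with exponent \<open>\<beta>\<close>\<close>

text \<open>The exponent with \<open>1/\<beta> = \<gamma> + 1\<close>. Since
  \<open>2 powr \<beta> = 3/2\<close>, the functions \<open>ent\<close> and \<open>quad\<close>
  below agree at \<open>1/4\<close>.\<close>

definition \<beta> :: real where
  "\<beta> = log 2 (3/2)"

lemma two_powr_beta: "2 powr \<beta> = 3/2"
  by (simp add: \<beta>_def)

text \<open>\<open>(3/2) ^ 12\<close> only slightly exceeds \<open>2 ^ 7\<close>. The precision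
  matters for the square of \<beta>, which is then at least \<open>49/144 > 1/3\<close>.\<close>

lemma beta_ge: "7/12 \<le> \<beta>"
proof -
  have "7 \<le> log 2 ((3/2) ^ 12 :: real)"
    using le_log_of_power[of 2 7 "(3/2) ^ 12"] by (simp add: power_divide)
  then show ?thesis
    by (subst (asm) log_nat_power) (auto simp: \<beta>_def)
qed

lemma beta_le: "\<beta> \<le> 3/5"
proof -
  have "log 2 ((3/2) ^ 5 :: real) \<le> 3"
    by (subst log_le_iff) (auto simp: power_divide)
  then show ?thesis
    by (subst (asm) log_nat_power) (auto simp: \<beta>_def)
qed

lemma beta_bounds: "0 < \<beta>" "\<beta> < 1" "1/2 \<le> \<beta>" "1 \<le> 1/\<beta>" "1/\<beta> \<le> 2"
  using beta_ge beta_le by (auto simp: field_simps)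

text \<open>Weighted arithmetic-geometric mean inequality for \<open>1 + w\<close> and
  \<open>1\<close> with weights \<open>a\<close> and \<open>1 - a\<close>.\<close>

lemma powr_le_tangent:
  fixes a w :: real
  assumes "0 \<le> a" "a \<le> 1" "-1 < w"
  shows "(1 + w) powr a \<le> 1 + a * w"
  using Youngs_inequality_0[of a "1 - a" "1 + w" 1] assms by (simp add: algebra_simps)

text \<open>The tangent bound for the exponent \<open>1 - a\<close>, put into the denominator of
  \<open>(1 + w) / (1 + w) powr (1 - a)\<close>. It gives a rational lower bound that is exact to
  first order at \<open>w = 0\<close>.\<close>

lemma powr_ge_pade:
  fixes a w :: real
  assumes "0 \<le> a" "a \<le> 1" "-1 < w"
  shows "(1 + w) / (1 + (1 - a) * w) \<le> (1 + w) powr a"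
proof -
  have "(1 + w) powr (1 - a) \<le> 1 + (1 - a) * w"
    using powr_le_tangent[of "1 - a" w] assms by simp
  moreover have "0 < (1 + w) powr (1 - a)"
    using assms by simp
  ultimately have "(1 + w) / (1 + (1 - a) * w) \<le> (1 + w) / (1 + w) powr (1 - a)"
    using assms by (intro divide_left_mono mult_pos_pos) linarith+
  also have "\<dots> = (1 + w) powr a"
    using assms by (simp add: powr_diff)
  finally show ?thesis .
qed

text \<open>The chord of a concave function, with equality at both ends because
  \<open>2 powr \<beta> = 3/2\<close>. The proof uses convexity of the inverse power
  \<open>1/\<beta>\<close>.\<close>

lemma powr_beta_ge_chord:
  assumes "0 \<le> t" "t \<le> 1"
  shows "1 + t/2 \<le> (1 + t) powr \<beta>"
proof -
  have "((1 - t) *\<^sub>R 1 + t *\<^sub>R (3/2)) powr (1/\<beta>) \<le> (1 - t) * 1 powr (1/\<beta>) + t * (3/2) powr (1/\<beta>)"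
    using assms beta_bounds by (intro convex_onD[OF powr_convex]) auto
  also have "(3/2) powr (1/\<beta>) = (2::real)"
    using beta_bounds(1) by (simp add: powr_powr flip: two_powr_beta)
  finally have "(1 + t/2) powr (1/\<beta>) \<le> 1 + t"
    by (simp add: algebra_simps)
  then have "((1 + t/2) powr (1/\<beta>)) powr \<beta> \<le> (1 + t) powr \<beta>"
    using beta_bounds by (intro powr_mono2) auto
  then show ?thesis
    using beta_bounds assms by (simp add: powr_powr)
qed

text \<open>After division by \<open>k powr \<beta>\<close>, with \<open>q = 1/k \<le> 1\<close>,
  the chord bound and \<open>q powr \<beta> \<le> sqrt q \<le> (1 + q)/2\<close> suffice.
  Integrality matters: the inequality fails with \<open>1/2\<close> in place of
  \<open>k\<close>.\<close>

lemma succ_powr_beta_ge: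
  "1 + real k powr \<beta> / 2 \<le> (real k + 1) powr \<beta>"
proof (cases "k = 0")
  case False
  define q where "q = 1 / real k"
  have q: "0 < q" "q \<le> 1"
    using False by (auto simp: q_def)
  have "q powr \<beta> \<le> q powr (1/2)"
    using q beta_bounds by (intro powr_mono') auto
  also have "\<dots> \<le> 1/2 + q/2"
    using powr_le_tangent[of "1/2" "q - 1"] q by (simp add: diff_divide_distrib)
  finally have "q powr \<beta> + 1/2 \<le> (1 + q) powr \<beta>"
    using powr_beta_ge_chord[of q] q by simp
  then have "real k powr \<beta> * (q powr \<beta> + 1/2) \<le> real k powr \<beta> * (1 + q) powr \<beta>"
    by (intro mult_left_mono) auto
  moreover have "real k powr \<beta> * q powr \<beta> = 1" "real k powr \<beta> * (1 + q) powr \<beta> = (real k + 1) powr \<beta>"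
    using False q by (auto simp: q_def algebra_simps simp flip: powr_mult)
  ultimately show ?thesis
    by (simp add: algebra_simps)
qed (use beta_bounds in auto)

text \<open>The pointwise form of the reverse Minkowski inequality in \<open>L\<^sup>\<beta>\<close>: with the weight \<open>\<theta>\<close>
  fixed in advance, the estimate is linear in \<open>h powr \<beta>\<close> and can be averaged.\<close>
lemma powr_add_ge:
  fixes a h e \<theta> :: real
  assumes "0 < a" "a < 1" "0 \<le> h" "0 \<le> e" "0 < \<theta>" "\<theta> < 1"
  shows "\<theta> powr (1 - a) * h powr a + (1 - \<theta>) powr (1 - a) * e powr a \<le> (h + e) powr a"
proof (cases "h = 0 \<or> e = 0")
  case True
  have "\<theta> powr (1 - a) \<le> 1" "(1 - \<theta>) powr (1 - a) \<le> 1"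
    using assms by (auto intro!: powr_le1)
  then show ?thesis
    using True assms by (auto intro!: mult_left_le_one_le)
next
  case False
  then have pos: "0 < h" "0 < e"
    using assms by auto
  \<comment> \<open>Young's inequality for the shares of \<open>h\<close> and \<open>e\<close> in
    \<open>h + e\<close>; the two right-hand sides add up to 1.\<close>
  have "(h / (h + e)) powr a * \<theta> powr (1 - a) \<le> a * (h / (h + e)) + (1 - a) * \<theta>"
       "(e / (h + e)) powr a * (1 - \<theta>) powr (1 - a) \<le> a * (e / (h + e)) + (1 - a) * (1 - \<theta>)"
    using assms pos by (intro Youngs_inequality_0; simp)+
  moreover have "a * (h / (h + e)) + a * (e / (h + e)) = a"
    using pos by (simp flip: distrib_left add_divide_distrib)
  ultimately have "(h / (h + e)) powr a * \<theta> powr (1 - a) + (e / (h + e)) powr a * (1 - \<theta>) powr (1 - a) \<le> 1"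
    by (simp add: algebra_simps)
  then show ?thesis
    using pos by (simp add: powr_divide field_simps)
qed

subsection \<open>Two-point inequalities\<close>

definition quad :: "real \<Rightarrow> real" where
  "quad x = 2 * x * (1 - x)"

text \<open>Agrees with \<open>quad\<close> at \<open>1/4\<close> and at \<open>1/2\<close>. The
  factor \<open>x\<close> makes the value at 0 equal to 0, whatever \<open>1 / 0\<close> is.\<close>

definition ent :: "real \<Rightarrow> real" where
  "ent x = x * log 2 (1 / x) powr \<beta>"

lemma quad_nonneg: "0 \<le> x \<Longrightarrow> x \<le> 1 \<Longrightarrow> 0 \<le> quad x"
  by (simp add: quad_def)

text \<open>By the parallelogram identity the maximum has to reach \<open>quad x + d^2\<close>,
  where \<open>d = x - y\<close>. The linear alternative does so when \<open>d \<ge> 1 - x\<close>.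
  Otherwise \<open>d \<le> min x (1 - x) \<le> quad x\<close>, and the chord bound applies to the
  Minkowski alternative.\<close>

lemma quad_two_point:
  assumes "0 \<le> y" "y \<le> x" "x \<le> 1"
  shows "2 * quad ((x + y) / 2) \<le>
    max ((quad x powr (1/\<beta>) + (x - y) powr (1/\<beta>)) powr \<beta>) (x - y + quad x / 2) + quad y"
proof -
  define d where "d = x - y"
  have d: "0 \<le> d" "d \<le> x" and y: "y = x - d"
    using assms by (auto simp: d_def)
  have mid: "2 * quad ((x + y) / 2) = quad x + quad y + d\<^sup>2"
    by (simp add: quad_def y field_simps power2_eq_square)
  show ?thesis
  proof (cases "1 - x \<le> d \<or> x = 0")
    case True
    \<comment> \<open>The mixed terms cancel on expansion, leaving
      \<open>x - x * x + d^2 \<le> d\<close>.\<close>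
    have "(d - (1 - x)) * (x - d) \<ge> 0"
      using True d by (cases "x = 0") (auto intro!: mult_nonneg_nonneg)
    moreover have "quad x / 2 = x - x * x"
      by (simp add: quad_def right_diff_distrib)
    ultimately have "quad x / 2 + d\<^sup>2 \<le> d"
      by (simp add: algebra_simps power2_eq_square)
    then show ?thesis
      unfolding mid d_def[symmetric] by linarith
  next
    case False
    then have x: "0 < x" "x < 1" "d \<le> 1 - x"
      using d by auto
    have dq: "d \<le> quad x"
    proof (cases "x \<le> 1/2")
      case True
      have "0 \<le> x * (1 - 2 * x)"
        using True x by simp
      then show ?thesis
        using d by (simp add: quad_def algebra_simps)
    next
      case False
      then have "0 \<le> (1 - x) * (2 * x - 1)"
        using x by simp
      then show ?thesis
        using x by (simp add: quad_def algebra_simps)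
    qed
    define q where "q = quad x"
    have q: "0 < q" "q \<le> 1/2"
      using x sum_squares_ge_zero[of "2*x-1" 0]
      by (auto simp: quad_def q_def algebra_simps)
    define t where "t = d / q"
    have t: "0 \<le> t" "t \<le> 1" "d = t * q"
      using d dq q by (auto simp: t_def q_def)
    have "t powr 2 \<le> t powr (1/\<beta>)"
      using t beta_bounds by (intro powr_mono') auto
    then have t2: "t\<^sup>2 \<le> t powr (1/\<beta>)"
      using t by simp
    \<comment> \<open>The factor 1/2 comes from \<open>q \<le> 1/2\<close> and matches the slope of
      \<open>powr_beta_ge_chord\<close>.\<close>
    have "q + d\<^sup>2 \<le> q * (1 + t\<^sup>2 / 2)"
    proof -
      have "(t\<^sup>2 * q) * q \<le> (t\<^sup>2 * q) * (1/2)"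
        using q by (intro mult_left_mono) auto
      then show ?thesis
        by (simp add: t algebra_simps power2_eq_square)
    qed
    also have "\<dots> \<le> q * (1 + t powr (1/\<beta>)) powr \<beta>"
      using t2 powr_beta_ge_chord[of "t powr (1/\<beta>)"] t q beta_bounds
      by (intro mult_left_mono) (auto simp: powr_le1)
    also have "\<dots> = (q powr (1/\<beta>) + d powr (1/\<beta>)) powr \<beta>"
    proof -
      have "q powr (1/\<beta>) + d powr (1/\<beta>) = q powr (1/\<beta>) * (1 + t powr (1/\<beta>))"
        using t q by (simp add: powr_mult algebra_simps)
      then show ?thesis
        using q beta_bounds by (simp add: powr_mult powr_powr)
    qed
    finally show ?thesis
      unfolding mid q_def d_def by simp
  qed
qed

text \<open>Since \<open>log 2 (8/3) = 2 - \<beta>\<close>, splitting at \<open>3/8\<close> reduces the comparison at the common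
  endpoint to \<open>\<beta> (1 - \<beta>) \<le> 1/4\<close> and \<open>\<beta>\<^sup>2 \<ge> 1/3\<close>.\<close>
lemma ent_le_quad:
  assumes "1/4 \<le> x" "x \<le> 1/2"
  shows "ent x \<le> quad x"
proof -
  define l where "l = - log 2 x"
  have cvx: "convex_on {u..v} (\<lambda>x. - log 2 x)" if "0 < u" for u v :: real
    using that by (intro convex_on_subset[OF minus_log_convex]) auto
  have l38: "- log 2 (3/8) = 2 - \<beta>"
  proof -
    have "\<beta> = log 2 (3/8 * 2 powr 2)"
      by (simp add: \<beta>_def)
    also have "\<dots> = log 2 (3/8) + 2"
      using log_mult_pos[of "3/8" "2 powr 2" 2] log_powr_cancel[of 2 2] by simp
    finally show ?thesis
      by simp
  qed
  have l14: "- log 2 (1/4) = (2::real)" and l12: "- log 2 (1/2) = (1::real)"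
    using log_pow_cancel[of 2 2] by (simp_all add: log_divide)
  have l1: "1 \<le> l"
    using assms log_le_cancel_iff[of 2 x "1/2"] l12 unfolding l_def by linarith
  have "l powr \<beta> \<le> 2 * (1 - x)"
  \<comment> \<open>On each half, \<open>l\<close> lies below a chord of the convex function
    \<open>- log 2\<close>. The power of \<open>l\<close> is then bounded by its tangent at
    \<open>l = 1\<close> on the upper half and at \<open>l = 2\<close> on the lower half.\<close>
  proof (cases "3/8 \<le> x")
    case True
    have "l \<le> (1 - (2 - \<beta>)) / (1/2 - 3/8) * (x - 3/8) + (2 - \<beta>)"
      using convex_onD_Icc'[OF cvx[of "3/8" "1/2"], of x] True assms
      unfolding l38 l12 l_def by simp
    then have "l - 1 \<le> (1 - \<beta>) * (4 - 8 * x)"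
      by (simp add: algebra_simps)
    then have "\<beta> * (l - 1) \<le> \<beta> * ((1 - \<beta>) * (4 - 8 * x))"
      using beta_bounds by (intro mult_left_mono) auto
    also have "\<dots> = (\<beta> * (1 - \<beta>)) * (4 - 8 * x)"
      by simp
    also have "\<dots> \<le> 1/4 * (4 - 8 * x)"
      using sum_squares_ge_zero[of "2*\<beta>-1" 0] assms
      by (intro mult_right_mono) (auto simp: algebra_simps)
    finally show ?thesis
      using powr_le_tangent[of \<beta> "l - 1"] l1 beta_bounds by (simp add: algebra_simps)
  next
    case False
    have l2: "l \<le> 2 - \<beta> * (8 * x - 2)"
      using convex_onD_Icc'[OF cvx[of "1/4" "3/8"], of x] False assms
      unfolding l38 l14 l_def by (simp add: algebra_simps)
    have "l powr \<beta> = 3/2 * (l/2) powr \<beta>"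
      using l1 by (simp add: powr_divide two_powr_beta)
    also have "\<dots> \<le> 3/2 * (1 + \<beta> * (l/2 - 1))"
      using powr_le_tangent[of \<beta> "l/2 - 1"] l1 beta_bounds by simp
    also have "\<dots> \<le> 3/2 * (1 - \<beta>\<^sup>2 * (4 * x - 1))"
      using mult_left_mono[OF l2, of \<beta>] beta_bounds by (simp add: algebra_simps power2_eq_square)
    also have "\<dots> \<le> 3/2 * (1 - 1/3 * (4 * x - 1))"
    proof -
      have "1/3 \<le> \<beta>\<^sup>2"
        using power_mono[OF beta_ge, of 2] by (simp add: power2_eq_square)
      from mult_right_mono[OF this, of "4 * x - 1"] show ?thesis
        using assms by simp
    qed
    finally show ?thesis
      by (simp add: algebra_simps)
  qed
  then have "x * l powr \<beta> \<le> x * (2 * (1 - x))"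
    using assms by (intro mult_left_mono) auto
  then show ?thesis
    using assms by (simp add: ent_def quad_def l_def log_divide)
qed

section \<open>Logarithm estimates and the entropy two-point inequality\<close>

lemma ln_le_half_diff_inverse:
  fixes x :: real
  assumes "1 \<le> x"
  shows "ln x \<le> (x - 1/x) / 2"
proof -
  have "(1 - 1/1) / 2 - ln 1 \<le> (x - 1/x) / 2 - ln x"
  proof (rule DERIV_nonneg_imp_nondecreasing[OF assms])
    fix t :: real
    assume "1 \<le> t" "t \<le> x"
    then have "((\<lambda>t. (t - 1/t) / 2 - ln t) has_real_derivative (1 - 1/t)\<^sup>2 / 2) (at t)"
      by (auto intro!: derivative_eq_intros simp: field_simps power2_eq_square)
    then show "\<exists>y. ((\<lambda>t. (t - 1/t) / 2 - ln t) has_real_derivative y) (at t) \<and> 0 \<le> y"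
      by (intro exI conjI) auto
  qed
  then show ?thesis
    by simp
qed

lemma ln_ge_pade:
  fixes x :: real
  assumes "1 \<le> x"
  shows "2 * (x - 1) / (x + 1) \<le> ln x"
proof -
  have "ln 1 - 2 * (1 - 1) / (1 + 1) \<le> ln x - 2 * (x - 1) / (x + 1)"
  proof (rule DERIV_nonneg_imp_nondecreasing[OF assms])
    fix t :: real
    assume "1 \<le> t" "t \<le> x"
    then have "((\<lambda>t. ln t - 2 * (t - 1) / (t + 1)) has_real_derivative
        1 / t - (2 * (t + 1) - 2 * (t - 1)) / ((t + 1) * (t + 1))) (at t)"
      by (auto intro!: derivative_eq_intros)
    moreover have "1 / t - (2 * (t + 1) - 2 * (t - 1)) / ((t + 1) * (t + 1)) = (t - 1)\<^sup>2 / (t * (t + 1)\<^sup>2)"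
      using \<open>1 \<le> t\<close> by (simp add: divide_simps) (simp add: algebra_simps power2_eq_square)
    ultimately have "((\<lambda>t. ln t - 2 * (t - 1) / (t + 1)) has_real_derivative
        (t - 1)\<^sup>2 / (t * (t + 1)\<^sup>2)) (at t)"
      by simp
    then show "\<exists>y. ((\<lambda>t. ln t - 2 * (t - 1) / (t + 1)) has_real_derivative y) (at t) \<and> 0 \<le> y"
      using \<open>1 \<le> t\<close> by (intro exI conjI) auto
  qed
  then show ?thesis
    by simp
qed

lemma ln_one_plus_ge_chord:
  fixes r :: real
  assumes "0 \<le> r" "r \<le> 1"
  shows "r * ln 2 \<le> ln (1 + r)"
proof -
  have "ln ((1 - r) *\<^sub>R 1 + r *\<^sub>R 2) \<ge> (1 - r) * ln 1 + r * ln 2"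
    using assms by (intro concave_onD[OF ln_concave]) auto
  then show ?thesis
    by (simp add: algebra_simps)
qed

text \<open>The right-hand side is the first-order part of \<open>ent_two_point_ratio\<close> in \<open>1/M\<close>, with
  \<open>(1 - r)^(1/\<beta>)\<close> weakened to \<open>(1 - r)\<^sup>2\<close>; the left-hand side pays for the error of \<open>powr_ge_pade\<close>.\<close>
lemma ln_entropy_ineq:
  fixes r :: real
  assumes "0 < r" "r \<le> 1"
  shows "r * (1 - r) * (1 + r) / 2 * (ln (1/r) - ln (2 / (1 + r)))
    \<le> 2 * ((1 - r)\<^sup>2 * ln 2 + r * ln (1/r) - (1 + r) * ln (2 / (1 + r)))"
proof -
  define b c where "b = ln (1/r)" and "c = ln (2 / (1 + r))"
  have "(1 + r) * (4 - r + r\<^sup>2) / 2 * c \<le> r * (3 + r\<^sup>2) / 2 * b + 2 * (1 - r)\<^sup>2 * ln 2"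
  \<comment> \<open>For small \<open>r\<close> every bound is a multiple of \<open>ln 2\<close>,
    using the tangent of \<open>ln\<close> at \<open>4 * r = 1\<close>. For larger \<open>r\<close>,
    \<open>b\<close> and \<open>c\<close> get rational bounds that are exact at
    \<open>r = 1\<close>.\<close>
  proof (cases "r \<le> 1/4")
    case True
    have "ln (4 * r) \<le> 4 * r - 1"
      using assms by (intro ln_le_minus_one) auto
    moreover have "ln (4 * r) = 2 * ln 2 - b"
      using assms ln_realpow[of 2 2] by (simp add: b_def ln_mult ln_div)
    moreover have "(1 - 4 * r) * ln 2 \<le> (1 - 4 * r) * 1"
      using True ln2_le_25_over_36 by (intro mult_left_mono) auto
    ultimately have b: "(3 - 4 * r) * ln 2 \<le> b"
      by (simp add: algebra_simps)
    have c: "c \<le> (1 - r) * ln 2"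
      using ln_one_plus_ge_chord[of r] assms by (simp add: c_def ln_div algebra_simps)
    \<comment> \<open>With the common factor \<open>ln 2\<close> removed, the two sides differ by
      \<open>r / 2\<close> times this cubic.\<close>
    have "0 \<le> 2 - 5 * r + 2 * r\<^sup>2 - 3 * r^3"
    proof -
      have "r^3 \<le> (1/4)^3"
        using True assms by (intro power_mono) auto
      then have "r^3 \<le> 1/64"
        by (simp add: power_divide)
      with zero_le_power2[of r] show ?thesis
        using True by linarith
    qed
    then have "0 \<le> r / 2 * (2 - 5 * r + 2 * r\<^sup>2 - 3 * r^3)"
      using assms by auto
    then have "(1 + r) * (4 - r + r\<^sup>2) / 2 * (1 - r) \<le> r * (3 + r\<^sup>2) / 2 * (3 - 4 * r) + 2 * (1 - r)\<^sup>2"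
      by (simp add: algebra_simps power2_eq_square power3_eq_cube add_divide_distrib diff_divide_distrib)
    from mult_right_mono[OF this, of "ln 2"]
    have "(1 + r) * (4 - r + r\<^sup>2) / 2 * ((1 - r) * ln 2)
        \<le> r * (3 + r\<^sup>2) / 2 * ((3 - 4 * r) * ln 2) + 2 * (1 - r)\<^sup>2 * ln 2"
      by (simp add: algebra_simps power2_eq_square add_divide_distrib diff_divide_distrib)
    moreover have "(1 + r) * (4 - r + r\<^sup>2) / 2 * c \<le> (1 + r) * (4 - r + r\<^sup>2) / 2 * ((1 - r) * ln 2)"
      using assms c by (intro mult_left_mono) auto
    moreover have "r * (3 + r\<^sup>2) / 2 * ((3 - 4 * r) * ln 2) \<le> r * (3 + r\<^sup>2) / 2 * b"
      using assms b by (intro mult_left_mono) auto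
    ultimately show ?thesis
      by linarith
  next
    case False
    have "2 * (1/r - 1) / (1/r + 1) = (2 * (1/r - 1) * r) / ((1/r + 1) * r)"
      using assms by simp
    also have "\<dots> = 2 * (1 - r) / (1 + r)"
      using assms by (simp add: algebra_simps)
    finally have "2 * (1/r - 1) / (1/r + 1) = 2 * (1 - r) / (1 + r)" .
    then have b: "2 * (1 - r) / (1 + r) \<le> b"
      using ln_ge_pade[of "1/r"] assms by (simp add: b_def)
    have "(2 / (1 + r) - 1 / (2 / (1 + r))) / 2 = (1 - r) * (3 + r) / (4 * (1 + r))"
      using assms by (simp add: field_simps)
    moreover have "c \<le> (2 / (1 + r) - 1 / (2 / (1 + r))) / 2"
      unfolding c_def using assms by (intro ln_le_half_diff_inverse) simp
    ultimately have c: "c \<le> (1 - r) * (3 + r) / (4 * (1 + r))"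
      by (simp only:)
    \<comment> \<open>The cubic left after \<open>(1 - r)^2 / (24 * (1 + r))\<close> is factored
      out, with \<open>ln 2\<close> replaced by \<open>2/3\<close>.\<close>
    have "0 \<le> -4 + 29 * r - 12 * r\<^sup>2 + 3 * r^3"
    proof -
      have "r * r \<le> r * 1"
        using assms by (intro mult_left_mono) auto
      then show ?thesis
        using False assms zero_le_power[of r 3] unfolding power2_eq_square by linarith
    qed
    then have "0 \<le> (1 - r)\<^sup>2 * (-4 + 29 * r - 12 * r\<^sup>2 + 3 * r^3) / (24 * (1 + r))"
      using assms by simp
    also have "\<dots> = r * (3 + r\<^sup>2) / 2 * (2 * (1 - r) / (1 + r)) + 2 * (1 - r)\<^sup>2 * (2/3)
        - (1 + r) * (4 - r + r\<^sup>2) / 2 * ((1 - r) * (3 + r) / (4 * (1 + r)))"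
      using assms by (simp add: divide_simps) (simp add: algebra_simps power2_eq_square power3_eq_cube)
    finally have "(1 + r) * (4 - r + r\<^sup>2) / 2 * ((1 - r) * (3 + r) / (4 * (1 + r)))
        \<le> r * (3 + r\<^sup>2) / 2 * (2 * (1 - r) / (1 + r)) + 2 * (1 - r)\<^sup>2 * (2/3)"
      by simp
    moreover have "(1 + r) * (4 - r + r\<^sup>2) / 2 * c \<le> (1 + r) * (4 - r + r\<^sup>2) / 2 * ((1 - r) * (3 + r) / (4 * (1 + r)))"
      using assms c by (intro mult_left_mono) auto
    moreover have "r * (3 + r\<^sup>2) / 2 * (2 * (1 - r) / (1 + r)) \<le> r * (3 + r\<^sup>2) / 2 * b"
      using assms b by (intro mult_left_mono) auto
    moreover have "2 * (1 - r)\<^sup>2 * (2/3) \<le> 2 * (1 - r)\<^sup>2 * ln 2"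
      using ln2_ge_two_thirds by (intro mult_left_mono) auto
    ultimately show ?thesis
      by linarith
  qed
  then show ?thesis
    unfolding b_def c_def
    by (simp add: algebra_simps power2_eq_square add_divide_distrib diff_divide_distrib)
qed

text \<open>This is \<open>ent_two_point\<close> divided by \<open>x\<close>, with \<open>r = y/x\<close> and \<open>M = log 2 (2/(x + y))\<close>.\<close>
lemma ent_two_point_ratio:
  fixes r M :: real
  assumes "0 < r" "r \<le> 1" "2 \<le> M"
  defines "u \<equiv> log 2 (2 / (1 + r)) - (1 - r) powr (1/\<beta>)"
  defines "v \<equiv> log 2 (1/r) - log 2 (2 / (1 + r))"
  shows "(1 + r) * M powr \<beta> \<le> (M - u) powr \<beta> + r * (M + v) powr \<beta>"
proof -
  define k where "k = 1 - \<beta>"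
  have k: "0 < k" "k \<le> 1/2"
    using beta_bounds by (auto simp: k_def)
  have v: "0 \<le> v"
    using assms by (auto simp: v_def field_simps intro!: log_mono)
  have "(1 - r) powr 2 \<le> (1 - r) powr (1/\<beta>)"
    using assms beta_bounds by (intro powr_mono') auto
  then have a: "(1 - r)\<^sup>2 \<le> (1 - r) powr (1/\<beta>)"
    using assms by (cases "r = 1") auto
  have "log 2 (2 / (1 + r)) \<le> 1 - r"
    using ln_one_plus_ge_chord[of r] assms
    by (simp add: log_def ln_div field_simps)
  then have u: "u \<le> r * (1 - r)"
    using a by (simp add: u_def algebra_simps power2_eq_square)
  also have "\<dots> < 1"
    using mult_right_mono[of r 1 "1 - r"] assms by simp
  finally have u1: "u < 1" .
  have key: "r * (1 - r) * (1 + r) / 2 * v \<le> 2 * (r * v - u)"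
  proof -
    have "r * (1 - r) * (1 + r) / 2 * v
        \<le> 2 * ((1 - r)\<^sup>2 + r * log 2 (1/r) - (1 + r) * log 2 (2 / (1 + r)))"
      using divide_right_mono[OF ln_entropy_ineq[OF assms(1,2)], of "ln 2"]
      by (simp add: v_def log_def diff_divide_distrib add_divide_distrib algebra_simps)
    also have "\<dots> \<le> 2 * (r * v - u)"
      using a by (simp add: u_def v_def algebra_simps)
    finally show ?thesis .
  qed
  have rvu: "0 \<le> r * v - u"
  proof -
    have "0 \<le> r * (1 - r) * (1 + r) / 2 * v"
      using assms v by simp
    from order_trans[OF this key] show ?thesis by simp
  qed
  \<comment> \<open>The target \<open>main\<close> rearranges to
    \<open>k * (1 + r) * u * v \<le> M * (r * v - u)\<close>. Since \<open>2 \<le> M\<close>,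
    \<open>key\<close> reduces it to this estimate.\<close>
  have "k * (1 + r) * u * v \<le> r * (1 - r) * (1 + r) / 2 * v"
  proof (cases "u \<le> 0")
    case True
    then have "k * (1 + r) * u * v \<le> 0"
      using k assms v by (intro mult_nonpos_nonneg mult_nonneg_nonpos) auto
    also have "\<dots> \<le> r * (1 - r) * (1 + r) / 2 * v"
      using assms v by simp
    finally show ?thesis .
  next
    case False
    have "k * u \<le> 1/2 * (r * (1 - r))"
      using k u False assms by (intro mult_mono) auto
    then have "k * u * ((1 + r) * v) \<le> 1/2 * (r * (1 - r)) * ((1 + r) * v)"
      using assms v by (intro mult_right_mono) auto
    then show ?thesis
      by (simp add: algebra_simps)
  qed
  also note key
  also have "2 * (r * v - u) \<le> M * (r * v - u)"
    using assms rvu by (intro mult_right_mono) auto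
  finally have main: "u * (M + k * v) \<le> r * v * (M - k * u)"
    by (simp add: algebra_simps)
  have ku: "k * u < M" 
  proof (cases "u \<le> 0")
    case True
    then have "k * u \<le> 0" using k by (simp add: mult_nonneg_nonpos)
    then show ?thesis using assms by linarith
  next
    case False
    then have "k * u \<le> 1 * u" using k by (intro mult_right_mono) auto
    then show ?thesis using u1 assms by linarith
  qed
  have kv: "0 < M + k * v"
    using assms k v by (simp add: add_pos_nonneg)
  have M: "0 < M"
    using assms by simp
  then have div_M: "1 + w / M = (M + w) / M" "1 + (1 - \<beta>) * (w / M) = (M + k * w) / M" for w
    by (simp_all add: k_def field_simps)
  have "(1 + r) * 1 \<le> (M - u) / (M - k * u) + r * ((M + v) / (M + k * v))"
  proof -
    have "(M - u) / (M - k * u) = 1 - \<beta> * (u / (M - k * u))"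
      using ku by (simp add: k_def field_simps)
    moreover have "(M + v) / (M + k * v) = 1 + \<beta> * (v / (M + k * v))"
      using kv by (simp add: k_def field_simps)
    moreover have "u / (M - k * u) \<le> r * v / (M + k * v)"
      using main ku kv by (simp add: divide_simps mult_ac)
    then have "\<beta> * (u / (M - k * u)) \<le> \<beta> * (r * v / (M + k * v))"
      using beta_bounds by (intro mult_left_mono) auto
    ultimately show ?thesis
      by (simp add: algebra_simps)
  qed
  also have "(M - u) / (M - k * u) = (1 + (- u / M)) / (1 + (1 - \<beta>) * (- u / M))"
    using M unfolding div_M by simp
  also have "\<dots> \<le> (1 + (- u / M)) powr \<beta>"
    using assms u1 beta_bounds by (intro powr_ge_pade) (auto simp: field_simps)
  also have "(M + v) / (M + k * v) = (1 + v / M) / (1 + (1 - \<beta>) * (v / M))"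
    using M unfolding div_M by simp
  also have "r * \<dots> \<le> r * (1 + v / M) powr \<beta>"
    using assms v beta_bounds by (intro mult_left_mono powr_ge_pade) (auto simp: less_le_trans[of _ 0])
  finally have "(1 + r) * 1 * M powr \<beta> \<le> ((1 + (- u / M)) powr \<beta> + r * (1 + v / M) powr \<beta>) * M powr \<beta>"
    by (intro mult_right_mono) auto
  also have "\<dots> = ((1 + (- u / M)) * M) powr \<beta> + r * ((1 + v / M) * M) powr \<beta>"
    unfolding powr_mult by (simp only: distrib_right mult.assoc)
  also have "\<dots> = (M - u) powr \<beta> + r * (M + v) powr \<beta>"
    using M by (simp add: left_diff_distrib distrib_right)
  finally show ?thesis
    by simp
qed

text \<open>Since \<open>log\<close> turns products into sums, every term is \<open>x\<close> times
  an expression in \<open>r = y/x\<close> and \<open>l = log 2 (1/x)\<close>. The condition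
  \<open>x + y \<le> 1/2\<close> becomes \<open>2 \<le> M\<close> for \<open>M = l + c\<close>. At
  \<open>r = 0\<close> both sides are equal.\<close>

lemma ent_two_point:
  assumes "0 \<le> y" "y \<le> x" "x \<le> 1/2" "x + y \<le> 1/2"
  shows "2 * ent ((x + y) / 2) \<le> (ent x powr (1/\<beta>) + (x - y) powr (1/\<beta>)) powr \<beta> + ent y"
proof (cases "x = 0")
  case True
  then show ?thesis
    using assms by (simp add: ent_def)
next
  case False
  then have x: "0 < x"
    using assms by auto
  define r where "r = y / x"
  define l where "l = log 2 (1/x)"
  have r: "0 \<le> r" "r \<le> 1" "y = x * r"
    using assms x by (auto simp: r_def)
  have l: "1 \<le> l"
    using assms x by (simp add: l_def le_log_iff field_simps)
  have "ent x powr (1/\<beta>) = x powr (1/\<beta>) * l"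
    using x l beta_bounds by (simp add: ent_def l_def[symmetric] powr_mult powr_powr)
  moreover have "x - y = x * (1 - r)"
    by (simp add: r algebra_simps)
  then have "(x - y) powr (1/\<beta>) = x powr (1/\<beta>) * (1 - r) powr (1/\<beta>)"
    by (simp only: powr_mult)
  ultimately have "ent x powr (1/\<beta>) + (x - y) powr (1/\<beta>) = x powr (1/\<beta>) * (l + (1 - r) powr (1/\<beta>))"
    by (simp add: algebra_simps)
  then have lhs: "(ent x powr (1/\<beta>) + (x - y) powr (1/\<beta>)) powr \<beta> = x * (l + (1 - r) powr (1/\<beta>)) powr \<beta>"
    using x l beta_bounds by (simp add: powr_mult powr_powr)
  define c where "c = log 2 (2 / (1 + r))"
  have mid: "2 * ent ((x + y) / 2) = x * ((1 + r) * (l + c) powr \<beta>)"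
  proof -
    have "1 / ((x + y) / 2) = 1 / x * (2 / (1 + r))"
      using x r by (simp add: field_simps)
    then have "log 2 (1 / ((x + y) / 2)) = l + c"
      using x r log_mult_pos[of "1/x" "2 / (1 + r)" 2] unfolding l_def c_def by simp
    then show ?thesis
      unfolding ent_def by (simp add: r algebra_simps)
  qed
  show ?thesis
  proof (cases "r = 0")
    case True
    then show ?thesis
      unfolding lhs mid by (simp add: c_def r ent_def)
  next
    case False
    then have r0: "0 < r"
      using r by auto
    have y: "ent y = x * (r * (l + log 2 (1/r)) powr \<beta>)"
    proof -
      have "1 / y = 1 / x * (1 / r)"
        by (simp add: r)
      then have "log 2 (1 / y) = l + log 2 (1/r)"
        using x r0 log_mult_pos[of "1/x" "1/r" 2] unfolding l_def by simp
      then show ?thesis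
        by (simp add: ent_def r algebra_simps)
    qed
    have "2 \<le> l + c"
    proof -
      have "l + c = log 2 (2 / (x + y))"
        using x r0 log_mult_pos[of "1/x" "2 / (1 + r)" 2] by (simp add: l_def c_def r algebra_simps)
      then show ?thesis
        using assms x by (simp add: le_log_iff field_simps)
    qed
    from ent_two_point_ratio[OF r0 r(2) this]
    have "x * ((1 + r) * (l + c) powr \<beta>)
        \<le> x * ((l + (1 - r) powr (1/\<beta>)) powr \<beta> + r * (l + log 2 (1/r)) powr \<beta>)"
      using x by (intro mult_left_mono) (auto simp: c_def algebra_simps)
    then show ?thesis
      unfolding lhs mid y by (simp add: algebra_simps)
  qed
qed

subsection \<open>Induction over the cube\<close>

definition slice :: "bool \<Rightarrow> bool list set \<Rightarrow> bool list set" where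
  "slice b A = {x. b # x \<in> A}"

definition cube_density :: "nat \<Rightarrow> bool list set \<Rightarrow> real" where
  "cube_density n A = card A / 2 ^ n"

text \<open>For \<open>A\<close> inside the cube this is the expectation of
  \<open>out_deg n A x powr \<beta>\<close>, as points outside \<open>A\<close> contribute
  \<open>0 powr \<beta> = 0\<close>.\<close>

definition energy :: "nat \<Rightarrow> bool list set \<Rightarrow> real" where
  "energy n A = (\<Sum>x\<in>A. out_deg n A x powr \<beta>) / 2 ^ n"

text \<open>The contribution of one half of the cube: \<open>T\<close> is the opposite slice, and a
  point of \<open>S\<close> missing from \<open>T\<close> has one more neighbour outside
  \<open>A\<close>, across the split.\<close>

definition slice_energy :: "nat \<Rightarrow> bool list set \<Rightarrow> bool list set \<Rightarrow> real" where
  "slice_energy n S T = (\<Sum>x\<in>S. (out_deg n S x + of_bool (x \<notin> T)) powr \<beta>) / 2 ^ n"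

section \<open>Splitting adjacency, degrees and sums along the first coordinate\<close>

lemma adjacent_iff_card:
  "adjacent n x y \<longleftrightarrow> x \<in> cube n \<and> y \<in> cube n \<and> card {i. i < n \<and> x ! i \<noteq> y ! i} = 1"
proof -
  have "(\<exists>!i. P i) \<longleftrightarrow> card {i. P i} = 1" for P :: "nat \<Rightarrow> bool"
    by (auto simp: card_1_singleton_iff set_eq_iff)
  then show ?thesis
    by (simp only: adjacent_def)
qed

lemma adjacent_Cons:
  assumes "x \<in> cube n" "y \<in> cube n"
  shows "adjacent (Suc n) (b # x) (c # y) \<longleftrightarrow> (if b = c then adjacent n x y else x = y)"
proof -
  let ?D = "{i. i < n \<and> x ! i \<noteq> y ! i}"
  have "{i. i < Suc n \<and> (b # x) ! i \<noteq> (c # y) ! i} = (if b = c then {} else {0}) \<union> Suc ` ?D"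
  proof (rule set_eqI)
    fix i
    show "i \<in> {i. i < Suc n \<and> (b # x) ! i \<noteq> (c # y) ! i}
        \<longleftrightarrow> i \<in> (if b = c then {} else {0}) \<union> Suc ` ?D"
      by (cases i) auto
  qed
  then have "card {i. i < Suc n \<and> (b # x) ! i \<noteq> (c # y) ! i} = (if b = c then 0 else 1) + card ?D"
    by (simp add: card_image card_insert_if image_iff)
  moreover have "card ?D = 0 \<longleftrightarrow> x = y"
    using assms by (auto simp: cube_def list_eq_iff_nth_eq)
  ultimately show ?thesis
    using assms by (auto simp: adjacent_iff_card cube_def)
qed

text \<open>Neighbours of \<open>b # x\<close> either share its first coordinate or equal
  \<open>(\<not> b) # x\<close>; the latter accounts for the \<open>of_bool\<close> term.\<close>

lemma out_deg_Cons:
  assumes "x \<in> cube n"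
  shows "out_deg (Suc n) A (b # x)
    = (if x \<in> slice b A then out_deg n (slice b A) x + of_bool (x \<notin> slice (\<not> b) A) else 0)"
proof (cases "x \<in> slice b A")
  case True
  let ?N = "{y \<in> cube n - slice b A. adjacent n x y}"
  have "{y \<in> cube (Suc n) - A. adjacent (Suc n) (b # x) y}
      = (#) b ` ?N \<union> (if x \<in> slice (\<not> b) A then {} else {(\<not> b) # x})"
  proof (rule set_eqI)
    fix z
    show "z \<in> {y \<in> cube (Suc n) - A. adjacent (Suc n) (b # x) y}
      \<longleftrightarrow> z \<in> (#) b ` ?N \<union> (if x \<in> slice (\<not> b) A then {} else {(\<not> b) # x})"
    proof (cases z)
      case Nil
      then show ?thesis
        by (auto simp: cube_def)
    next
      case (Cons c y)
      show ?thesis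
      proof (cases "y \<in> cube n")
        case True
        then have cube: "c # y \<in> cube (Suc n)"
          by (simp add: cube_def)
        show ?thesis
        proof (cases "c = b")
          case same: True
          show ?thesis
            using True cube unfolding Cons same by (simp add: adjacent_Cons[OF assms True] slice_def image_iff)
        next
          case False
          then have c: "c = (\<not> b)"
            by simp
          show ?thesis
            using cube unfolding Cons c by (auto simp: adjacent_Cons[OF assms True] slice_def image_iff)
        qed
      next
        case False
        then show ?thesis
          using assms by (auto simp: Cons cube_def)
      qed
    qed
  qed
  moreover have "finite ?N"
    using finite_cube[of n] by simp
  ultimately have "card {y \<in> cube (Suc n) - A. adjacent (Suc n) (b # x) y}
      = card ?N + of_bool (x \<notin> slice (\<not> b) A)"
    by (cases "x \<in> slice (\<not> b) A") (simp_all add: card_image image_iff)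
  then show ?thesis
    using True by (simp add: out_deg_def slice_def)
qed (auto simp: out_deg_def slice_def)

lemma slice_subset_cube: "A \<subseteq> cube (Suc n) \<Longrightarrow> slice b A \<subseteq> cube n"
  by (auto simp: slice_def cube_def)

lemma finite_subset_cube: "A \<subseteq> cube n \<Longrightarrow> finite A"
  using finite_cube finite_subset by blast

lemma sum_slices:
  assumes "A \<subseteq> cube (Suc n)"
  shows "sum f A = (\<Sum>x\<in>slice b A. f (b # x)) + (\<Sum>x\<in>slice (\<not> b) A. f ((\<not> b) # x))"
proof -
  have A: "A = (#) b ` slice b A \<union> (#) (\<not> b) ` slice (\<not> b) A"
  proof (rule set_eqI)
    fix z
    show "z \<in> A \<longleftrightarrow> z \<in> (#) b ` slice b A \<union> (#) (\<not> b) ` slice (\<not> b) A"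
    proof (cases z)
      case Nil
      then show ?thesis
        using assms by (auto simp: cube_def)
    next
      case (Cons c y)
      then show ?thesis
        by (cases b; cases c) (auto simp: slice_def)
    qed
  qed
  have fin: "finite (slice c A)" for c
    using finite_subset_cube[OF slice_subset_cube[OF assms]] .
  show ?thesis
    by (subst A, subst sum.union_disjoint) (auto simp: sum.reindex fin)
qed

lemma cube_density_slices:
  assumes "A \<subseteq> cube (Suc n)"
  shows "cube_density (Suc n) A = (cube_density n (slice b A) + cube_density n (slice (\<not> b) A)) / 2"
  using sum_slices[OF assms, of "\<lambda>_. 1 :: real" b] by (simp add: cube_density_def field_simps)

lemma energy_slices:
  assumes "A \<subseteq> cube (Suc n)"
  shows "2 * energy (Suc n) A
    = slice_energy n (slice b A) (slice (\<not> b) A) + slice_energy n (slice (\<not> b) A) (slice b A)"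
proof -
  have "(\<Sum>x\<in>slice c A. out_deg (Suc n) A (c # x) powr \<beta>)
      = (\<Sum>x\<in>slice c A. (out_deg n (slice c A) x + of_bool (x \<notin> slice (\<not> c) A)) powr \<beta>)" for c
    using slice_subset_cube[OF assms, of c] by (intro sum.cong) (auto simp: out_deg_Cons)
  from this[of b] this[of "\<not> b"] show ?thesis
    unfolding energy_def slice_energy_def sum_slices[OF assms, of _ b] by (simp add: add_divide_distrib)
qed

lemma out_deg_nonneg: "0 \<le> out_deg n A x"
  by (simp add: out_deg_def)

lemma cube_density_le_1: "A \<subseteq> cube n \<Longrightarrow> cube_density n A \<le> 1"
proof -
  assume "A \<subseteq> cube n"
  then have "card A \<le> card (cube n)"
    by (intro card_mono finite_cube)
  also have "card (cube n) = 2 ^ n"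
    using card_lists_length_eq[of "UNIV :: bool set" n] by (simp add: cube_def)
  finally show ?thesis
    by (simp add: cube_density_def)
qed

text \<open>The right-hand side is the density of \<open>S - T\<close>, the set of points that gain
  a neighbour outside \<open>A\<close>.\<close>

lemma cube_density_diff_le:
  assumes "S \<subseteq> cube n" "T \<subseteq> cube n"
  shows "cube_density n S - cube_density n T \<le> (\<Sum>x\<in>S. of_bool (x \<notin> T)) / 2 ^ n"
proof -
  have fin: "finite S" "finite T"
    using assms by (auto intro: finite_subset_cube)
  then have "card S \<le> card ((S - T) \<union> T)"
    by (intro card_mono) auto
  also have "\<dots> \<le> card (S - T) + card T"
    by (rule card_Un_le)
  finally have "real (card S) - real (card T) \<le> real (card (S - T))"
    by simp
  moreover have "(\<Sum>x\<in>S. of_bool (x \<notin> T)) = real (card (S - T))"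
    using fin by (simp add: sum_of_bool_eq set_diff_eq Int_def)
  ultimately show ?thesis
    by (simp add: cube_density_def diff_divide_distrib[symmetric] divide_right_mono)
qed

section \<open>Lower bounds for the energy of a slice\<close>

lemma slice_energy_ge: "energy n S \<le> slice_energy n S T"
  unfolding energy_def slice_energy_def using beta_bounds
  by (intro divide_right_mono sum_mono powr_mono2) (auto simp: out_deg_nonneg)

text \<open>Degrees are integers, so \<open>succ_powr_beta_ge\<close> applies at each point outside
  \<open>T\<close>; at points of \<open>T\<close> half of the power is given away.\<close>

lemma slice_energy_ge_linear:
  assumes "S \<subseteq> cube n" "T \<subseteq> cube n"
  shows "cube_density n S - cube_density n T + energy n S / 2 \<le> slice_energy n S T"
proof -
  have "of_bool (x \<notin> T) + out_deg n S x powr \<beta> / 2 \<le> (out_deg n S x + of_bool (x \<notin> T)) powr \<beta>" for x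
  proof -
    obtain k :: nat where k: "out_deg n S x = real k"
      by (cases "x \<in> S") (auto simp: out_deg_def intro: that[of 0])
    then show ?thesis
      using succ_powr_beta_ge[of k] powr_ge_zero[of "real k" \<beta>] by (cases "x \<in> T") auto
  qed
  then have "(\<Sum>x\<in>S. of_bool (x \<notin> T) + out_deg n S x powr \<beta> / 2)
      \<le> (\<Sum>x\<in>S. (out_deg n S x + of_bool (x \<notin> T)) powr \<beta>)"
    by (intro sum_mono)
  from divide_right_mono[OF this, of "2 ^ n"]
  have "(\<Sum>x\<in>S. of_bool (x \<notin> T)) / 2 ^ n + energy n S / 2 \<le> slice_energy n S T"
    by (simp add: slice_energy_def energy_def sum.distrib add_divide_distrib sum_divide_distrib mult.commute)
  then show ?thesis
    using cube_density_diff_le[OF assms] by linarith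
qed

text \<open>Averaging \<open>powr_add_ge\<close> over \<open>S\<close> with the optimal weight
  \<theta> gives the reverse Minkowski inequality.\<close>

lemma slice_energy_ge_minkowski:
  assumes "S \<subseteq> cube n" "T \<subseteq> cube n" "cube_density n T \<le> cube_density n S"
    and "0 \<le> B" "B \<le> energy n S"
  shows "(B powr (1/\<beta>) + (cube_density n S - cube_density n T) powr (1/\<beta>)) powr \<beta> \<le> slice_energy n S T"
proof -
  define d where "d = cube_density n S - cube_density n T"
  have d: "0 \<le> d" "d \<le> (\<Sum>x\<in>S. of_bool (x \<notin> T)) / 2 ^ n"
    using assms cube_density_diff_le[OF assms(1,2)] by (auto simp: d_def)
  \<comment> \<open>If \<open>B\<close> or \<open>d\<close> vanishes, the optimal weight is an
    endpoint of the unit interval or undefined, so these cases are separate.\<close>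
  have "B = 0 \<or> d = 0 \<or> (0 < B \<and> 0 < d)"
    using assms d by auto
  then have "(B powr (1/\<beta>) + d powr (1/\<beta>)) powr \<beta> \<le> slice_energy n S T"
  proof (elim disjE)
    assume "B = 0"
    have "0 \<le> energy n S"
      by (auto simp: energy_def intro!: divide_nonneg_nonneg sum_nonneg)
    then have "d \<le> slice_energy n S T"
      using slice_energy_ge_linear[OF assms(1,2)] by (simp add: d_def)
    then show ?thesis
      using \<open>B = 0\<close> d beta_bounds by (simp add: powr_powr)
  next
    assume "d = 0"
    then show ?thesis
      using assms slice_energy_ge[of n S T] beta_bounds by (simp add: powr_powr)
  next
    assume pos: "0 < B \<and> 0 < d"
    define P D where "P = B powr (1/\<beta>)" and "D = d powr (1/\<beta>)"
    \<comment> \<open>With this weight the combination of \<open>B\<close> and \<open>d\<close>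
      equals \<open>(P + D) powr \<beta>\<close> exactly.\<close>
    define \<theta> where "\<theta> = P / (P + D)"
    have PD: "0 < P" "0 < D"
      using pos by (auto simp: P_def D_def)
    then have \<theta>: "0 < \<theta>" "\<theta> < 1" "1 - \<theta> = D / (P + D)"
      by (auto simp: \<theta>_def field_simps)
    have B: "B = P powr \<beta>" and dD: "d = D powr \<beta>"
      using pos beta_bounds by (auto simp: P_def D_def powr_powr)
    have sum1: "P powr (1 - \<beta>) * P powr \<beta> = P" "D powr (1 - \<beta>) * D powr \<beta> = D"
      using PD by (simp_all flip: powr_add)
    have "(P + D) powr \<beta> = (P + D) / (P + D) powr (1 - \<beta>)"
      using PD by (simp add: powr_diff)
    also have "\<dots> = \<theta> powr (1 - \<beta>) * B + (1 - \<theta>) powr (1 - \<beta>) * d"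
      unfolding \<theta>(3) unfolding \<theta>_def B dD using PD sum1 by (simp add: powr_divide add_divide_distrib)
    also have "\<dots> \<le> \<theta> powr (1 - \<beta>) * energy n S + (1 - \<theta>) powr (1 - \<beta>) * ((\<Sum>x\<in>S. of_bool (x \<notin> T)) / 2 ^ n)"
      using assms d by (intro add_mono mult_left_mono) auto
    also have "\<dots> = (\<Sum>x\<in>S. \<theta> powr (1 - \<beta>) * out_deg n S x powr \<beta> + (1 - \<theta>) powr (1 - \<beta>) * of_bool (x \<notin> T) powr \<beta>) / 2 ^ n"
    proof -
      have "of_bool b powr \<beta> = (of_bool b :: real)" for b
        by (cases b) auto
      then show ?thesis
        by (simp only: energy_def sum.distrib sum_distrib_left[symmetric] add_divide_distrib times_divide_eq_right)
    qed
    also have "\<dots> \<le> slice_energy n S T"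
      unfolding slice_energy_def using \<theta> beta_bounds
      by (intro divide_right_mono sum_mono powr_add_ge) (auto simp: out_deg_nonneg)
    finally show ?thesis
      by (simp add: P_def D_def)
  qed
  then show ?thesis
    by (simp add: d_def)
qed

text \<open>One induction proves both bounds, because the entropy bound falls back on the quadratic
  one in the same dimension.\<close>

lemma energy_lower_bounds:
  assumes "A \<subseteq> cube n"
  shows "quad (cube_density n A) \<le> energy n A"
    and "cube_density n A \<le> 1/2 \<Longrightarrow> ent (cube_density n A) \<le> energy n A"
proof -
  have "quad (cube_density n A) \<le> energy n A \<and> (cube_density n A \<le> 1/2 \<longrightarrow> ent (cube_density n A) \<le> energy n A)"
    using assms
  proof (induction n arbitrary: A)
    case 0
    have "A = {} \<or> A = {[]}"
      using 0 by (auto simp: cube_def)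
    then show ?case
      by (auto simp: cube_density_def energy_def quad_def ent_def)
  next
    case (Suc n)
    obtain b where b: "cube_density n (slice (\<not> b) A) \<le> cube_density n (slice b A)"
      by (cases "cube_density n (slice False A) \<le> cube_density n (slice True A)")
        (use that[of True] that[of False] in auto)
    define S T where "S = slice b A" and "T = slice (\<not> b) A"
    define x y where "x = cube_density n S" and "y = cube_density n T"
    have ST: "S \<subseteq> cube n" "T \<subseteq> cube n"
      using slice_subset_cube[OF Suc.prems] by (auto simp: S_def T_def)
    have xy: "0 \<le> y" "y \<le> x" "x \<le> 1"
      using b cube_density_le_1[OF ST(1)] by (auto simp: x_def y_def S_def T_def cube_density_def)
    have z: "cube_density (Suc n) A = (x + y) / 2"
      using cube_density_slices[OF Suc.prems, of b] by (simp add: x_def y_def S_def T_def)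
    \<comment> \<open>Only the gain in the denser slice \<open>S\<close> is kept; for
      \<open>T\<close> the neighbours across the split are ignored.\<close>
    have e: "slice_energy n S T + energy n T \<le> 2 * energy (Suc n) A"
      using energy_slices[OF Suc.prems, of b] slice_energy_ge[of n T S] by (simp add: S_def T_def)
    have mink: "(B powr (1/\<beta>) + (x - y) powr (1/\<beta>)) powr \<beta> \<le> slice_energy n S T"
      if "0 \<le> B" "B \<le> energy n S" for B
      using slice_energy_ge_minkowski[OF ST _ that] xy by (simp add: x_def y_def)
    have quad: "quad ((x + y) / 2) \<le> energy (Suc n) A"
    proof -
      have q: "quad x \<le> energy n S" "quad y \<le> energy n T"
        using Suc.IH ST by (auto simp: x_def y_def)
      have "x - y + quad x / 2 \<le> slice_energy n S T"
        using slice_energy_ge_linear[OF ST] q by (simp add: x_def y_def)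
      then have "max ((quad x powr (1/\<beta>) + (x - y) powr (1/\<beta>)) powr \<beta>) (x - y + quad x / 2)
          \<le> slice_energy n S T"
        using mink[of "quad x"] q quad_nonneg[of x] xy by simp
      then show ?thesis
        using quad_two_point[OF xy] q e by linarith
    qed
    have "ent ((x + y) / 2) \<le> energy (Suc n) A" if "(x + y) / 2 \<le> 1/2"
    proof (cases "x + y \<le> 1/2")
      case True
      then have x: "x \<le> 1/2"
        using xy by simp
      then have "ent x \<le> energy n S" "ent y \<le> energy n T"
        using Suc.IH ST xy by (auto simp: x_def y_def)
      moreover have "0 \<le> ent x"
        using xy by (simp add: ent_def)
      ultimately show ?thesis
        using ent_two_point[OF xy(1,2) x True] mink[of "ent x"] e by linarith
    next
      case False
      then show ?thesis
        using ent_le_quad[of "(x + y) / 2"] that by (intro order_trans[OF _ quad]) simp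
    qed
    with quad show ?case
      by (simp add: z)
  qed
  then show "quad (cube_density n A) \<le> energy n A"
    and "cube_density n A \<le> 1/2 \<Longrightarrow> ent (cube_density n A) \<le> energy n A"
    by auto
qed

subsection \<open>From the power mean to the expectation\<close>

text \<open>Here \<open>k\<close> is the number of fixed coordinates: flipping one of them is the
  only way to leave the subcube in one step.\<close>

lemma is_subcube_out_deg:
  assumes "is_subcube n A"
  shows "\<exists>k::nat. cube_density n A = 1 / 2 ^ k \<and> (\<forall>x\<in>A. out_deg n A x = k)"
  using assms
proof (induction n arbitrary: A)
  case 0
  then have "A = {[]}"
    by (auto simp: is_subcube_def cube_def)
  then show ?case
    by (intro exI[of _ 0]) (auto simp: cube_density_def out_deg_def cube_def)
next
  case (Suc n)
  then obtain I a where I: "I \<subseteq> {..<Suc n}" and A: "A = {x \<in> cube (Suc n). \<forall>i\<in>I. x ! i = a i}"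
    by (auto simp: is_subcube_def)
  define S where "S = {x \<in> cube n. \<forall>i\<in>{i. Suc i \<in> I}. x ! i = a (Suc i)}"
  have "is_subcube n S"
    unfolding is_subcube_def using I
    by (intro exI[of _ "{i. Suc i \<in> I}"] exI[of _ "\<lambda>i. a (Suc i)"]) (auto simp: S_def)
  from Suc.IH[OF this] obtain k :: nat where
    k: "cube_density n S = 1 / 2 ^ k" "\<And>x. x \<in> S \<Longrightarrow> out_deg n S x = k"
    by auto
  have slice: "slice b A = (if 0 \<in> I \<and> b \<noteq> a 0 then {} else S)" for b
  proof -
    have "b # x \<in> A \<longleftrightarrow> (0 \<in> I \<longrightarrow> b = a 0) \<and> x \<in> S" for x
    proof -
      have "(\<forall>i\<in>I. (b # x) ! i = a i) \<longleftrightarrow> (0 \<in> I \<longrightarrow> b = a 0) \<and> (\<forall>i. Suc i \<in> I \<longrightarrow> x ! i = a (Suc i))"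
        by (metis not0_implies_Suc nth_Cons_0 nth_Cons_Suc)
      then show ?thesis
        by (auto simp: A S_def cube_def)
    qed
    then show ?thesis
      by (auto simp: slice_def)
  qed
  have sub: "A \<subseteq> cube (Suc n)" and S: "S \<subseteq> cube n"
    by (auto simp: A S_def)
  \<comment> \<open>Fixing the first coordinate empties one slice, which halves the density and adds
    one outside neighbour to every point.\<close>
  let ?k = "k + of_bool (0 \<in> I)"
  have "cube_density (Suc n) A = 1 / 2 ^ ?k"
    unfolding cube_density_slices[OF sub, of "a 0"] slice k(1)[symmetric]
    by (auto simp: k(1)) (simp add: cube_density_def)
  moreover have "out_deg (Suc n) A x = ?k" if "x \<in> A" for x
  proof (cases x)
    case Nil
    then show ?thesis
      using that sub by (auto simp: cube_def)
  next
    case (Cons b y)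
    then have "y \<in> slice b A"
      using that by (simp add: slice_def)
    then have y: "y \<in> S" "y \<in> cube n" "0 \<in> I \<Longrightarrow> b = a 0"
      using S by (auto simp: slice split: if_splits)
    then show ?thesis
      unfolding Cons out_deg_Cons[OF y(2)] slice using k(2) by auto
  qed
  ultimately show ?case
    by blast
qed

lemma cube_prob_eq_density: "A \<subseteq> cube n \<Longrightarrow> cube_prob n A = cube_density n A"
  using card_lists_length_eq[of "UNIV :: bool set" n]
  by (simp add: measure_pmf_of_set[OF cube_nonempty finite_cube] cube_density_def Int_absorb1)
     (simp add: cube_def)

lemma cube_expectation_out_deg:
  assumes "A \<subseteq> cube n"
  shows "cube_expectation n (out_deg n A) = (\<Sum>x\<in>A. out_deg n A x) / 2 ^ n"
proof -
  have "sum (out_deg n A) (cube n) = sum (out_deg n A) A"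
    using assms by (intro sum.mono_neutral_right) (auto simp: finite_cube out_deg_def)
  moreover have "card (cube n) = 2 ^ n"
    using card_lists_length_eq[of "UNIV :: bool set" n] by (simp add: cube_def)
  ultimately show ?thesis
    by (simp add: integral_pmf_of_set[OF cube_nonempty finite_cube])
qed

lemma vertex_boundary_subset: "vertex_boundary n A \<subseteq> A"
  by (auto simp: vertex_boundary_def out_deg_def)

text \<open>Hoelder's inequality for \<open>out_deg\<close> to the power \<beta> times the indicator
  of the boundary, with exponents \<open>1/\<beta>\<close> and
  \<open>1/(1 - \<beta>)\<close>.\<close>

lemma energy_holder:
  assumes "A \<subseteq> cube n" "vertex_boundary n A \<noteq> {}"
  shows "energy n A \<le> ((\<Sum>x\<in>A. out_deg n A x) / 2 ^ n) powr \<beta>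
    * cube_density n (vertex_boundary n A) powr (1 - \<beta>)"
proof -
  let ?D = "vertex_boundary n A"
  define H d where "H = (\<Sum>x\<in>?D. out_deg n A x) / 2 ^ n" and "d = cube_density n ?D"
  have fin: "finite A" "finite ?D"
    using finite_subset_cube[OF assms(1)] finite_subset[OF vertex_boundary_subset] by auto
  have pos: "0 < out_deg n A x" if "x \<in> ?D" for x
    using that out_deg_nonneg[of n A x] by (simp add: vertex_boundary_def)
  have zero: "out_deg n A x = 0" if "x \<in> A - ?D" for x
    using that assms(1) by (auto simp: vertex_boundary_def)
  have H: "H = (\<Sum>x\<in>A. out_deg n A x) / 2 ^ n"
    unfolding H_def using fin zero vertex_boundary_subset
    by (intro arg_cong2[where f = "(/)"] sum.mono_neutral_left) auto
  have E: "energy n A = (\<Sum>x\<in>?D. out_deg n A x powr \<beta>) / 2 ^ n"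
    unfolding energy_def using fin zero vertex_boundary_subset
    by (intro arg_cong2[where f = "(/)"] sum.mono_neutral_right) auto
  have d: "0 < d"
    using assms(2) fin by (simp add: d_def cube_density_def card_gt_0_iff)
  have "0 < H"
    unfolding H_def using fin assms(2) pos by (intro divide_pos_pos sum_pos) auto
  \<comment> \<open>The mean of \<open>out_deg\<close> over the boundary. With it the summed Young
    bound collapses to \<open>H\<close>.\<close>
  define c where "c = H / d"
  have c: "0 < c" "c * d = H"
    using d \<open>0 < H\<close> by (auto simp: c_def)
  have "(\<Sum>x\<in>?D. out_deg n A x powr \<beta> * c powr (1 - \<beta>)) \<le> (\<Sum>x\<in>?D. \<beta> * out_deg n A x + (1 - \<beta>) * c)"
    using pos c beta_bounds by (intro sum_mono Youngs_inequality_0) auto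
  from divide_right_mono[OF this, of "2 ^ n"]
  have "energy n A * c powr (1 - \<beta>) \<le> \<beta> * H + (1 - \<beta>) * (c * d)"
    by (simp add: E H_def d_def cube_density_def sum.distrib add_divide_distrib
        flip: sum_distrib_left sum_distrib_right) (simp add: mult_ac)
  also have "\<dots> = H"
    by (simp add: c algebra_simps)
  finally have "energy n A \<le> H / c powr (1 - \<beta>)"
    using c by (simp add: field_simps)
  also have "\<dots> = H powr \<beta> * d powr (1 - \<beta>)"
    using \<open>0 < H\<close> d by (simp add: c_def powr_divide powr_diff)
  finally show ?thesis
    unfolding H d_def .
qed

theorem corollary1p2:
  fixes n :: nat and A :: "bool list set"
  assumes "n \<ge> 1"
    and "A \<subseteq> cube n"
    and "A \<noteq> {}"
    and "cube_prob n A \<le> 1 / 2"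
  shows "cube_expectation n (out_deg n A) \<ge>
           (cube_prob n A / cube_prob n (vertex_boundary n A)) powr \<gamma>
             * cube_prob n A * log 2 (1 / cube_prob n A)
       \<and> (is_subcube n A \<longrightarrow>
           cube_expectation n (out_deg n A) =
             (cube_prob n A / cube_prob n (vertex_boundary n A)) powr \<gamma>
               * cube_prob n A * log 2 (1 / cube_prob n A))"
proof -
  define m where "m = cube_density n A"
  define d where "d = cube_density n (vertex_boundary n A)"
  define H where "H = (\<Sum>x\<in>A. out_deg n A x) / 2 ^ n"
  define l where "l = log 2 (1/m)"
  have probs: "cube_prob n A = m" "cube_prob n (vertex_boundary n A) = d"
    "cube_expectation n (out_deg n A) = H"
    using assms(2) vertex_boundary_subset[of n A]
    by (auto simp: m_def d_def H_def cube_prob_eq_density cube_expectation_out_deg)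
  have fin: "finite A"
    using finite_subset_cube assms by blast
  have m: "0 < m" "m \<le> 1/2"
    using assms(3,4) fin unfolding probs by (auto simp: m_def cube_density_def card_gt_0_iff)
  have l: "1 \<le> l"
    using m by (simp add: l_def le_log_iff field_simps)
  have ent: "m * l powr \<beta> \<le> energy n A"
    using energy_lower_bounds(2)[OF assms(2)] m by (simp add: m_def l_def ent_def)
  \<comment> \<open>An empty boundary would make the energy 0, against the entropy bound, which is
    positive because \<open>1 \<le> l\<close>.\<close>
  have ne: "vertex_boundary n A \<noteq> {}"
  proof
    assume "vertex_boundary n A = {}"
    then have "energy n A = 0"
      using assms(2) by (auto simp: energy_def vertex_boundary_def intro!: sum.neutral)
    with ent m l show False
      by (simp add: mult_le_0_iff)
  qed
  have d: "0 < d"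
    using ne fin finite_subset[OF vertex_boundary_subset fin]
    by (simp add: d_def cube_density_def card_gt_0_iff)
  have H: "0 \<le> H"
    by (auto simp: H_def out_deg_nonneg intro!: divide_nonneg_nonneg sum_nonneg)
  have \<gamma>: "\<gamma> = 1/\<beta> - 1"
    by (simp add: \<gamma>_def \<beta>_def)
  have "m * l powr \<beta> \<le> H powr \<beta> * d powr (1 - \<beta>)"
    using ent energy_holder[OF assms(2) ne] by (simp add: H_def d_def)
  \<comment> \<open>Raising to the power \<open>1/\<beta>\<close> isolates \<open>H\<close>, and the
    exponent of \<open>d\<close> becomes \<open>(1 - \<beta>)/\<beta> = \<gamma>\<close>.\<close>
  then have "(m * l powr \<beta>) powr (1/\<beta>) \<le> (H powr \<beta> * d powr (1 - \<beta>)) powr (1/\<beta>)"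
    using m beta_bounds by (intro powr_mono2) auto
  moreover have "(m * l powr \<beta>) powr (1/\<beta>) = m powr (1/\<beta>) * l"
    using m l beta_bounds by (simp add: powr_mult powr_powr)
  moreover have "(H powr \<beta> * d powr (1 - \<beta>)) powr (1/\<beta>) = H * d powr \<gamma>"
    using H d beta_bounds by (simp add: powr_mult powr_powr \<gamma> diff_divide_distrib)
  moreover have "m powr (1/\<beta>) = m powr \<gamma> * m"
    using m by (simp add: \<gamma> powr_diff)
  ultimately have "(m / d) powr \<gamma> * m * l \<le> H"
    using d m by (simp add: powr_divide field_simps)
  moreover have "H = (m / d) powr \<gamma> * m * l" if subcube: "is_subcube n A"
  proof -
    obtain k :: nat where k: "m = 1 / 2 ^ k" "\<And>x. x \<in> A \<Longrightarrow> out_deg n A x = k"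
      using is_subcube_out_deg[OF subcube] by (auto simp: m_def)
    \<comment> \<open>As \<open>k\<close> is positive, every point of \<open>A\<close> is a boundary
      point. The density ratio is then 1, and both sides equal \<open>m * k\<close>.\<close>
    have "k \<noteq> 0"
      using k(1) m by (intro notI) simp
    then have "vertex_boundary n A = A"
      using k(2) assms(2) by (auto simp: vertex_boundary_def out_deg_def split: if_splits)
    moreover have "H = m * k"
      using k(2) by (simp add: H_def m_def cube_density_def)
    moreover have "l = k"
      by (simp add: l_def k(1))
    ultimately show ?thesis
      using m by (simp add: d_def m_def)
  qed
  ultimately show ?thesis
    unfolding probs l_def by blast
qed

end
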